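(* Let $$\mathrm{S2}(z,q)=\sum_{n=1}^\infty\frac{q^{2n}(q^{2n+2};q^2)_\infty(-q^{2n+1};q^2)_\infty}{(zq^{2n};q^2)_\infty(z^{-1}q^{2n};q^2)_\infty}.$$ Then, in $\mathbb{Z}[z,z^{-1}][[q]]$, $$(z;q^2)_\infty(z^{-1};q^2)_\infty(q^2;q^2)_\infty\,\mathrm{S2}(z,-q)=\sum_{n=0}^\infty\sum_{m=0}^n(-1)^n(1-z^{n-m})^2z^{m-n}q^{\frac12(2n^2-m^2)+\frac12(2n-m)}.$$
   Context: Notation: $(a;q^2)_\infty=\prod_{k\ge 0}(1-aq^{2k})$. $\mathrm{S2}(z,-q)$ is obtained from $\mathrm{S2}(z,q)$ by replacing $q$ by $-q$. $\mathrm{S2}(z,q)$ is the generating function of the spt-crank for partitions with distinct odd parts and smallest part even. *)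

theory Defs
  imports
    "HOL-Analysis.Infinite_Products"
    "HOL-Computational_Algebra.Formal_Power_Series"
    "HOL-Library.Poly_Mapping"
begin

text \<open>
  The ring of Laurent polynomials in z over the integers is represented as the group ring of the
  additive group of the integers: a Laurent polynomial is a finitely supported map from exponents
  to coefficients, and multiplication is convolution.  Infinite sums and products of power series
  in q over this ring are taken in the metric of \<^typ>\<open>'a fps\<close>, that is, with respect to
  coefficientwise eventual stabilisation.
\<close>

type_synonym laurent = "int \<Rightarrow>\<^sub>0 int"

text \<open>The monomial z to the power k, for any integer k, as a constant power series in q.\<close>

definition zpow :: "int \<Rightarrow> laurent fps" where
  "zpow k = fps_const (Poly_Mapping.single k 1)"

text \<open>The infinite q-Pochhammer symbol with base b.\<close>

definition qpoch_inf :: "laurent fps \<Rightarrow> laurent fps \<Rightarrow> laurent fps" where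
  "qpoch_inf a b = prodinf (\<lambda>k. 1 - a * b ^ k)"

text \<open>
  The Laurent polynomials have no \<^const>\<open>inverse\<close>, so the reciprocal of
  the denominator is formed with \<^term>\<open>fps_right_inverse\<close>, whose second argument is the inverse
  of the constant coefficient; that coefficient is 1 for positive n if q has constant
  coefficient 0.
\<close>

definition S2_term :: "laurent fps \<Rightarrow> nat \<Rightarrow> laurent fps" where
  "S2_term q n =
     q ^ (2*n) * qpoch_inf (q ^ (2*n + 2)) (q\<^sup>2) * qpoch_inf (- (q ^ (2*n + 1))) (q\<^sup>2) *
     fps_right_inverse
       (qpoch_inf (zpow 1 * q ^ (2*n)) (q\<^sup>2) * qpoch_inf (zpow (-1) * q ^ (2*n)) (q\<^sup>2)) 1"

text \<open>The argument q makes it possible to substitute \<^term>\<open>- fps_X\<close> for the variable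
  \<^term>\<open>fps_X\<close>; the series is only meaningful if q has constant coefficient 0.\<close>

definition S2 :: "laurent fps \<Rightarrow> laurent fps" where
  "S2 q = suminf (\<lambda>n. S2_term q (Suc n))"

end

theory Submission
  imports Defs
begin

text \<open>
  Put \<open>p = q\<^sup>2\<close>.  The products in front of S2 turn its \<open>n\<close>-th summand into
  \<open>p\<^sup>n (z;p)\<^sub>n (1/z;p)\<^sub>n\<close> times a series in \<open>q\<close> alone.  By the finite triple product, the coefficient of
  \<open>z\<^sup>j\<close> in \<open>(z;p)\<^sub>n (1/z;p)\<^sub>n\<close> is \<open>(-1)\<^sup>j q^(j\<^sup>2 - j) (1 + p\<^sup>j) / (1 + p\<^sup>n)\<close> times the Gaussian binomial
  coefficient of \<open>2n\<close> over \<open>n + j\<close>.  For \<open>j > 0\<close> the sum over \<open>n\<close> is therefore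
  \<open>(-1)\<^sup>j q^(j\<^sup>2 + j) G(q^(2j))\<close>, where
  \<open>G(x) = (xq;q) (p;p) \<Sum>k. p\<^sup>k (-x;q)\<^sub>2\<^sub>k / ((p;p)\<^sub>k (x\<^sup>2p;p)\<^sub>k)\<close> (Pochhammer symbols without index are infinite).
  The summands of \<open>G(x) + xq G(xq)\<close> telescope and add up to \<open>1\<close>; iteration gives the partial
  theta function \<open>G(x) = \<Sum>m. (-1)\<^sup>m x\<^sup>m q^(m(m+1)/2)\<close>, which yields the coefficient on the right.
  Negative \<open>j\<close> follow by symmetry, and \<open>j = 0\<close> because both sides vanish at \<open>z = 1\<close>.
\<close>

section \<open>Infinite sums and products of formal power series\<close>

unbundle no vec_syntax
unbundle fps_syntax

lemma X_power_dvd_nth: "N < n \<Longrightarrow> fps_X ^ n dvd (f :: 'a::comm_ring_1 fps) \<Longrightarrow> f $ N = 0"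
  by (auto simp: dvd_def fps_X_power_mult_nth)

lemma X_power_dvd_mono: "m \<le> n \<Longrightarrow> fps_X ^ n dvd (f :: 'a::comm_ring_1 fps) \<Longrightarrow> fps_X ^ m dvd f"
  using le_imp_power_dvd dvd_trans by blast

lemma X_power_dvd_all_eq_0:
  fixes f :: "'a::comm_ring_1 fps"
  assumes "\<And>n. fps_X ^ n dvd f"
  shows "f = 0"
  using X_power_dvd_nth[OF lessI assms] by (intro fps_ext) auto

lemma X_dvd_iff: "fps_X dvd (f :: 'a::comm_ring_1 fps) \<longleftrightarrow> f $ 0 = 0"
proof
  assume "f $ 0 = 0"
  then have "f = fps_X * fps_shift 1 f"
    by (intro fps_ext) simp
  then show "fps_X dvd f" by (rule dvdI)
qed (auto simp: dvd_def)

text \<open>The hypothesis, which recurs for all series below, freezes the coefficient of q^N once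
  the first N + 1 summands have been added.\<close>

lemma fps_sums:
  fixes f :: "nat \<Rightarrow> 'a::comm_ring_1 fps"
  assumes "\<And>n. fps_X ^ n dvd f n"
  shows "f sums Abs_fps (\<lambda>N. \<Sum>n\<le>N. f n $ N)"
  unfolding sums_def
proof (rule tendsto_fpsI)
  fix N
  have "(\<Sum>n<M. f n) $ N = (\<Sum>n\<le>N. f n $ N)" if "M > N" for M
    unfolding fps_sum_nth
    by (rule sum.mono_neutral_right) (use that X_power_dvd_nth[OF _ assms] in auto)
  then show "\<forall>\<^sub>F M in sequentially. (\<Sum>n<M. f n) $ N = Abs_fps (\<lambda>N. \<Sum>n\<le>N. f n $ N) $ N"
    by (intro eventually_mono[OF eventually_gt_at_top[of N]]) simp
qed

lemma fps_suminf_nth: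
  fixes f :: "nat \<Rightarrow> 'a::comm_ring_1 fps"
  assumes "\<And>n. fps_X ^ n dvd f n" and "N \<le> M"
  shows "suminf f $ N = (\<Sum>n\<le>M. f n $ N)"
proof -
  have "suminf f $ N = (\<Sum>n\<le>N. f n $ N)"
    using sums_unique[OF fps_sums[OF assms(1)]] by (metis fps_nth_Abs_fps)
  also have "\<dots> = (\<Sum>n\<le>M. f n $ N)"
    by (rule sum.mono_neutral_left) (use assms X_power_dvd_nth[OF _ assms(1)] in auto)
  finally show ?thesis .
qed

text \<open>Each coefficient involves only finitely many summands, so exchanging two finite sums
  suffices.\<close>

lemma fps_suminf_cmult:
  fixes f :: "nat \<Rightarrow> 'a::comm_ring_1 fps"
  assumes "\<And>n. fps_X ^ n dvd f n"
  shows "suminf (\<lambda>n. c * f n) = c * suminf f"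
proof (rule fps_ext)
  fix N
  have "suminf (\<lambda>n. c * f n) $ N = (\<Sum>n\<le>N. (c * f n) $ N)"
    by (rule fps_suminf_nth) (use assms in auto)
  also have "\<dots> = (\<Sum>i=0..N. c $ i * (\<Sum>n\<le>N. f n $ (N - i)))"
    unfolding fps_mult_nth sum_distrib_left by (rule sum.swap)
  also have "\<dots> = (c * suminf f) $ N"
    unfolding fps_mult_nth
    by (intro sum.cong refl arg_cong2[where f = "(*)"] fps_suminf_nth[symmetric] assms) auto
  finally show "suminf (\<lambda>n. c * f n) $ N = (c * suminf f) $ N" .
qed

lemma fps_suminf_add:
  fixes f g :: "nat \<Rightarrow> 'a::comm_ring_1 fps"
  assumes "\<And>n. fps_X ^ n dvd f n" "\<And>n. fps_X ^ n dvd g n"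
  shows "suminf (\<lambda>n. f n + g n) = suminf f + suminf g"
  by (rule fps_ext)
    (simp add: fps_suminf_nth[OF assms(1) order_refl] fps_suminf_nth[OF assms(2) order_refl]
      fps_suminf_nth[OF dvd_add[OF assms] order_refl] sum.distrib)

lemma fps_suminf_Suc:
  fixes f :: "nat \<Rightarrow> 'a::comm_ring_1 fps"
  assumes "\<And>n. fps_X ^ n dvd f n"
  shows "suminf f = f 0 + suminf (\<lambda>n. f (Suc n))"
proof (rule fps_ext)
  fix N
  have "fps_X ^ n dvd f (Suc n)" for n
    by (rule X_power_dvd_mono[OF _ assms]) simp
  then show "suminf f $ N = (f 0 + suminf (\<lambda>n. f (Suc n))) $ N"
    using fps_suminf_nth[OF assms, of N "Suc N"] fps_suminf_nth[of "\<lambda>n. f (Suc n)" N N]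
    by (simp add: sum.atMost_Suc_shift del: sum.atMost_Suc)
qed

lemma fps_suminf_shift:
  fixes f :: "nat \<Rightarrow> 'a::comm_ring_1 fps"
  assumes "\<And>n. fps_X ^ n dvd f n" and "\<And>n. n < J \<Longrightarrow> f n = 0"
  shows "suminf f = suminf (\<lambda>k. f (J + k))"
  using assms(2)
proof (induction J)
  case (Suc J)
  have "fps_X ^ k dvd f (J + k)" for k
    by (rule X_power_dvd_mono[OF _ assms(1)]) simp
  from fps_suminf_Suc[OF this] Suc show ?case by simp
qed simp

lemma fps_suminf_eqI:
  fixes f :: "nat \<Rightarrow> 'a::comm_ring_1 fps"
  assumes "\<And>n. fps_X ^ n dvd f n" and "\<And>n. fps_X ^ n dvd (\<Sum>k<n. f k) - L"
  shows "suminf f = L"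
proof (rule fps_ext)
  fix N
  show "suminf f $ N = L $ N"
    using fps_suminf_nth[OF assms(1) order_refl, of N] X_power_dvd_nth[OF lessI assms(2), of N]
    by (simp add: fps_sum_nth lessThan_Suc_atMost)
qed

section \<open>Infinite q-Pochhammer symbols: convergence and functional equation\<close>

lemma qpoch_inf_tendsto:
  assumes b: "fps_X dvd b" and a: "a $ 0 \<noteq> 1"
  shows "(\<lambda>n. \<Prod>k\<le>n. 1 - a * b ^ k) \<longlonglongrightarrow> qpoch_inf a b" and "qpoch_inf a b \<noteq> 0"
proof -
  define P where "P n = (\<Prod>k\<le>n. 1 - a * b ^ k)" for n
  have P_eq: "P = (\<lambda>n. \<Prod>k\<le>n. 1 - a * b ^ k)"
    by (simp add: fun_eq_iff P_def)
  define L where "L = Abs_fps (\<lambda>N. P N $ N)"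
  \<comment> \<open>Factor number k differs from 1 by a multiple of q^k, so the factors after the
    N-th leave the coefficient of q^N alone.\<close>
  have "P (N + d) $ N = P N $ N" for N d
  proof (induction d)
    case (Suc d)
    have "fps_X ^ Suc (N + d) dvd P (N + d) * (a * b ^ Suc (N + d))"
      by (intro dvd_mult dvd_power_same b)
    then have "(P (N + d) * (a * b ^ Suc (N + d))) $ N = 0"
      by (rule X_power_dvd_nth[rotated]) simp
    moreover have "P (N + Suc d) = P (N + d) - P (N + d) * (a * b ^ Suc (N + d))"
      by (simp add: P_def right_diff_distrib)
    ultimately show ?case using Suc by (simp only: fps_sub_nth diff_zero)
  qed simp
  then have PN: "P M $ N = P N $ N" if "N \<le> M" for M N
    using that by (metis le_add_diff_inverse)
  have lim: "P \<longlonglongrightarrow> L"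
  proof (rule tendsto_fpsI)
    show "\<forall>\<^sub>F M in sequentially. P M $ N = L $ N" for N
      by (intro eventually_mono[OF eventually_ge_at_top[of N]]) (unfold L_def fps_nth_Abs_fps, erule PN)
  qed
  \<comment> \<open>\<open>raw_has_prod\<close> demands a nonzero limit. The condition on
    \<open>a $ 0\<close> secures it and, unlike divisibility of \<open>a\<close> by q, also admits z
    and 1/z.\<close>
  have "L $ 0 \<noteq> 0"
    using a by (simp add: L_def P_def)
  then have "L \<noteq> 0" by auto
  with lim have "(\<lambda>k. 1 - a * b ^ k) has_prod L"
    by (simp add: has_prod_def raw_has_prod_def P_eq)
  then have "qpoch_inf a b = L"
    unfolding qpoch_inf_def by (rule has_prod_unique[symmetric])
  with lim \<open>L \<noteq> 0\<close> show "(\<lambda>n. \<Prod>k\<le>n. 1 - a * b ^ k) \<longlonglongrightarrow> qpoch_inf a b" "qpoch_inf a b \<noteq> 0"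
    by (simp_all add: P_eq)
qed

lemma qpoch_inf_nth:
  assumes "fps_X dvd b" "a $ 0 \<noteq> 1"
  shows "\<exists>n. \<forall>m\<ge>n. qpoch_inf a b $ N = (\<Prod>k\<le>m. 1 - a * b ^ k) $ N"
  using qpoch_inf_tendsto(1)[OF assms]
  unfolding tendsto_fps_iff eventually_sequentially by metis

lemma qpoch_inf_Suc:
  assumes b: "fps_X dvd b" and a: "a $ 0 \<noteq> 1"
  shows "qpoch_inf a b = (1 - a) * qpoch_inf (a * b) b"
proof (rule LIMSEQ_unique)
  show "(\<lambda>n. \<Prod>k\<le>Suc n. 1 - a * b ^ k) \<longlonglongrightarrow> qpoch_inf a b"
    using qpoch_inf_tendsto(1)[OF assms] by (rule LIMSEQ_Suc)
  have ab: "(a * b) $ 0 \<noteq> 1"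
    using b by (auto simp: X_dvd_iff)
  show "(\<lambda>n. \<Prod>k\<le>Suc n. 1 - a * b ^ k) \<longlonglongrightarrow> (1 - a) * qpoch_inf (a * b) b"
  proof (rule tendsto_fpsI)
    fix N
    have *: "(\<Prod>k\<le>Suc n. 1 - a * b ^ k) = (1 - a) * (\<Prod>k\<le>n. 1 - (a * b) * b ^ k)" for n
      by (simp add: prod.atMost_Suc_shift mult.assoc del: prod.atMost_Suc)
    \<comment> \<open>Coefficient N of the product with 1 - a involves all coefficients up to N, so
      these must have stabilised simultaneously.\<close>
    have "\<forall>\<^sub>F n in sequentially. \<forall>i\<in>{..N}. (\<Prod>k\<le>n. 1 - (a * b) * b ^ k) $ i = qpoch_inf (a * b) b $ i"
      using qpoch_inf_tendsto(1)[OF b ab] by (simp add: eventually_ball_finite_distrib tendsto_fps_iff)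
    then show "\<forall>\<^sub>F n in sequentially. (\<Prod>k\<le>Suc n. 1 - a * b ^ k) $ N = ((1 - a) * qpoch_inf (a * b) b) $ N"
      unfolding * by eventually_elim (simp add: fps_mult_nth)
  qed
qed

lemma qpoch_inf_split:
  assumes b: "fps_X dvd b" and a: "a $ 0 \<noteq> 1"
  shows "qpoch_inf a b = (\<Prod>k<n. 1 - a * b ^ k) * qpoch_inf (a * b ^ n) b"
proof (induction n)
  case (Suc n)
  have "(a * b ^ n) $ 0 \<noteq> 1"
    using b a by (cases n) (auto simp: X_dvd_iff)
  from qpoch_inf_Suc[OF b this] Suc show ?case
    by (simp add: mult_ac)
qed simp

text \<open>Every factor is 1 modulo \<open>a\<close>, hence modulo q^n. The congruence passes from
  the finite products to the limit coefficient by coefficient.\<close>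

lemma qpoch_inf_cong_1:
  assumes b: "fps_X dvd b" and a: "fps_X ^ n dvd a" and n: "n > 0"
  shows "fps_X ^ n dvd qpoch_inf a b - 1"
proof -
  have a0: "a $ 0 \<noteq> 1"
    using X_power_dvd_nth[OF n a] by simp
  have "fps_X ^ n dvd (\<Prod>k\<le>m. 1 - a * b ^ k) - 1" for m
  proof (induction m)
    case (Suc m)
    have "(\<Prod>k\<le>Suc m. 1 - a * b ^ k) - 1 = ((\<Prod>k\<le>m. 1 - a * b ^ k) - 1) - a * (b ^ Suc m * (\<Prod>k\<le>m. 1 - a * b ^ k))"
      by (simp add: algebra_simps)
    with Suc a show ?case by (metis dvd_diff dvd_mult2)
  qed (use a in simp)
  then have *: "((\<Prod>k\<le>m. 1 - a * b ^ k) - 1) $ N = 0" if "N < n" for m N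
    by (rule X_power_dvd_nth[OF that])
  have "(qpoch_inf a b - 1) $ N = 0" if "N < n" for N
  proof -
    obtain m where "qpoch_inf a b $ N = (\<Prod>k\<le>m. 1 - a * b ^ k) $ N"
      using qpoch_inf_nth[OF b a0, of N] by blast
    with *[OF that, of m] show ?thesis by simp
  qed
  then have "qpoch_inf a b - 1 = fps_X ^ n * fps_shift n (qpoch_inf a b - 1)"
    by (intro fps_ext) (auto simp: fps_X_power_mult_nth)
  then show ?thesis by (rule dvdI)
qed

section \<open>A partial theta identity\<close>

definition qp :: "nat \<Rightarrow> nat \<Rightarrow> laurent fps" where
  "qp a b = qpoch_inf (fps_X ^ a) (fps_X ^ b)"

lemma qp_Suc: "a > 0 \<Longrightarrow> b > 0 \<Longrightarrow> qp a b = (1 - fps_X ^ a) * qp (a + b) b"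
  unfolding qp_def power_add by (rule qpoch_inf_Suc) (simp_all add: X_dvd_iff)

lemma qp_nonzero: "a > 0 \<Longrightarrow> b > 0 \<Longrightarrow> qp a b \<noteq> 0"
  unfolding qp_def by (rule qpoch_inf_tendsto(2)) (simp_all add: X_dvd_iff)

lemma qp_cong_1: "a > 0 \<Longrightarrow> b > 0 \<Longrightarrow> n \<le> a \<Longrightarrow> fps_X ^ n dvd qp a b - 1"
  unfolding qp_def
  by (rule X_power_dvd_mono, assumption, rule qpoch_inf_cong_1) (simp_all add: X_dvd_iff)

text \<open>Several identities below are proved after multiplication by such a factor, which is then
  cancelled in the integral domain.\<close>

lemma one_plus_X_power_nonzero: "1 + fps_X ^ n \<noteq> (0 :: laurent fps)"
proof
  assume "1 + fps_X ^ n = (0 :: laurent fps)"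
  then have "(1 + fps_X ^ n) $ 0 = (0 :: laurent)" by simp
  then show False by (cases "n = 0") simp_all
qed

text \<open>The \<open>k\<close>-th summand of \<open>G(x)\<close> at \<open>x = q\<^sup>i\<close>, with all denominators cancelled; the cancellation leaves
  a factor \<open>1 / (1 + x)\<close> when \<open>k = 0\<close>, hence the case distinction.\<close>

definition phi_term :: "nat \<Rightarrow> nat \<Rightarrow> laurent fps" where
  "phi_term i k = (if k = 0 then 1 else 1 + fps_X ^ i) * fps_X ^ (2*k) *
     qp (2*k + 2) 2 * qp (i + k + 1) 1 * (\<Prod>s=1..<k. 1 + fps_X ^ (i + k + s))"

text \<open>The partial sums of \<open>G(x) + xq G(xq)\<close>, found by creative telescoping.\<close>

definition phi_sum :: "nat \<Rightarrow> nat \<Rightarrow> laurent fps" where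
  "phi_sum i K = (if K = 0 then 0
     else qp (2*K) 2 * qp (i + K + 1) 1 * (\<Prod>s=1..<K. 1 + fps_X ^ (i + K + s)))"

text \<open>For K > 0 and up to the common factors \<open>A\<close>, \<open>B\<close>,
  \<open>M\<close>, this is a polynomial identity in q, x = q^i and u = q^(2K); v enters only
  through v^2 = x^2 q^2 u. Multiplication by 1 + xu trades \<open>V\<close> for \<open>M\<close>;
  this factor is cancelled at the end.\<close>

lemma phi_step:
  "phi_term i K + fps_X ^ (i + 1) * phi_term (i + 1) K = phi_sum i (Suc K) - phi_sum i K"
proof (cases "K = 0")
  case True
  \<comment> \<open>With this factor split off, the two terms combine through (1 - q^(i+1)) +
    q^(i+1) = 1.\<close>
  have *: "qp (Suc i) (Suc 0) = (1 - fps_X ^ Suc i) * qp (Suc (Suc i)) (Suc 0)"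
    using qp_Suc[of "Suc i" 1] by simp
  show ?thesis
    by (simp add: * True phi_term_def phi_sum_def algebra_simps)
next
  case False
  define M V :: "laurent fps" where "M = (\<Prod>s=1..<K. 1 + fps_X ^ (i + 1 + K + s))"
    and "V = (\<Prod>s=1..<K. 1 + fps_X ^ (i + K + s))"
  define q u x v :: "laurent fps"
    where "q = fps_X" and "u = fps_X ^ (2*K)" and "x = fps_X ^ i" and "v = fps_X ^ (i + K + 1)"
  define A B where "A = qp (2*K + 2) 2" and "B = qp (i + K + 2) 1"
  have v2: "v * v = x * x * q * q * u"
    by (simp add: v_def x_def q_def u_def flip: power_add power_Suc2)
  have xu: "fps_X ^ (i + K + K) = x * u" and xqu: "fps_X ^ (i + Suc K + K) = x * q * u"
  proof -
    have "u = fps_X ^ K * fps_X ^ K"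
      by (simp add: u_def mult_2 power_add)
    then show "fps_X ^ (i + K + K) = x * u" "fps_X ^ (i + Suc K + K) = x * q * u"
      by (simp_all add: x_def q_def power_add mult_ac)
  qed
  \<comment> \<open>\<open>V\<close> lacks the last and \<open>M\<close> the first factor of one and
    the same product.\<close>
  have 1: "(1 + x * u) * V = (\<Prod>s=1..<Suc K. 1 + fps_X ^ (i + K + s))"
    using False by (subst prod.atLeastLessThan_Suc) (simp_all add: V_def xu mult_ac)
  have 2: "(1 + v) * M = (\<Prod>s=1..<Suc K. 1 + fps_X ^ (i + K + s))"
    using False unfolding M_def v_def
    by (subst prod.atLeast_Suc_lessThan)
      (simp_all add: prod.atLeast_Suc_lessThan_Suc_shift add_ac del: prod.op_ivl_Suc)
  have VM: "(1 + x * u) * V = (1 + v) * M"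
    using 1 2 by simp
  have P: "(\<Prod>s=1..<Suc K. 1 + fps_X ^ (i + Suc K + s)) = M * (1 + x * q * u)"
    using False by (subst prod.atLeastLessThan_Suc) (simp_all add: M_def flip: xqu)
  have qp1: "qp (2*K) 2 = (1 - u) * A"
    using False qp_Suc[of "2*K" 2] by (simp add: A_def u_def)
  have qp2: "qp (i + K + 1) 1 = (1 - v) * B"
    using qp_Suc[of "i + K + 1" 1] by (simp add: B_def v_def)
  have T1: "phi_term i K = (1 + x) * u * A * ((1 - v) * B) * V"
    using False by (simp add: phi_term_def u_def x_def A_def V_def flip: qp2)
  have T2: "phi_term (i + 1) K = (1 + x * q) * u * A * B * M"
    using False by (simp add: phi_term_def u_def x_def A_def M_def B_def q_def mult_ac)
  have R1: "phi_sum i (Suc K) = A * B * (M * (1 + x * q * u))"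
    by (simp add: phi_sum_def A_def B_def flip: P)
  have R2: "phi_sum i K = (1 - u) * A * ((1 - v) * B) * V"
    using False by (simp add: phi_sum_def V_def flip: qp1 qp2)
  have xq: "fps_X ^ (i + 1) = x * q"
    by (simp add: x_def q_def)
  have "(1 + x * u) * (phi_term i K + x * q * phi_term (i + 1) K) =
      A * B * ((1 + x) * u * (1 - v) * ((1 + x * u) * V) + (1 + x * u) * x * q * (1 + x * q) * u * M)"
    unfolding T1 T2 by (simp add: algebra_simps)
  also have "\<dots> = A * B * M * ((1 + x) * u * (1 - v * v) + (1 + x * u) * x * q * (1 + x * q) * u)"
    unfolding VM by (simp add: algebra_simps)
  also have "\<dots> = A * B * M * ((1 + x * u) * (1 + x * q * u) - (1 - u) * (1 - v * v))"
    unfolding v2 by (simp add: algebra_simps)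
  also have "\<dots> = (1 + x * u) * (A * B * (M * (1 + x * q * u))) - (1 - u) * A * ((1 - v) * B) * ((1 + v) * M)"
    by (simp add: algebra_simps)
  also have "\<dots> = (1 + x * u) * (phi_sum i (Suc K) - phi_sum i K)"
    unfolding VM[symmetric] R1 R2 by (simp add: algebra_simps)
  finally show ?thesis
    using one_plus_X_power_nonzero[of "i + K + K"] unfolding xu xq by simp
qed

lemma phi_term_dvd: "fps_X ^ k dvd phi_term i k"
proof -
  have "fps_X ^ k dvd (fps_X ^ (2*k) :: laurent fps)"
    by (rule le_imp_power_dvd) simp
  then show ?thesis
    unfolding phi_term_def by (intro dvd_mult2 dvd_mult)
qed

lemma dvd_mult_minus_1:
  fixes a b d :: "'a::comm_ring_1"
  assumes "d dvd a - 1" "d dvd b - 1"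
  shows "d dvd a * b - 1"
proof -
  have "a * b - 1 = (a - 1) * b + (b - 1)"
    by (simp add: algebra_simps)
  with assms show ?thesis by (metis dvd_add dvd_mult2)
qed

text \<open>Each of its factors is 1 modulo q^K. Hence the telescoped sums tend to 1.\<close>

lemma phi_sum_cong_1:
  assumes "K > 0"
  shows "fps_X ^ K dvd phi_sum i K - 1"
proof -
  have "fps_X ^ K dvd (\<Prod>s=1..<n. 1 + fps_X ^ (i + K + s)) - (1 :: laurent fps)" for n
  proof (induction n)
    case (Suc n)
    have "fps_X ^ K dvd (1 + fps_X ^ (i + K + n)) - (1 :: laurent fps)"
      by (simp add: le_imp_power_dvd)
    with Suc show ?case
      by (cases "n \<ge> 1") (simp_all add: prod.atLeastLessThan_Suc dvd_mult_minus_1)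
  qed simp
  then show ?thesis
    using assms unfolding phi_sum_def by (simp add: dvd_mult_minus_1 qp_cong_1)
qed

text \<open>The functional equation G(x) + xq G(xq) = 1 at x = q^i.\<close>

lemma suminf_phi_term:
  "suminf (phi_term i) + fps_X ^ (i + 1) * suminf (phi_term (i + 1)) = 1"
proof -
  have *: "fps_X ^ n dvd fps_X ^ (i + 1) * phi_term (i + 1) n" for n
    by (intro dvd_mult phi_term_dvd)
  have "suminf (\<lambda>k. phi_term i k + fps_X ^ (i + 1) * phi_term (i + 1) k) = 1"
  proof (rule fps_suminf_eqI)
    fix n
    show "fps_X ^ n dvd phi_term i n + fps_X ^ (i + 1) * phi_term (i + 1) n"
      by (intro dvd_add * phi_term_dvd)
    have "(\<Sum>k<n. phi_term i k + fps_X ^ (i + 1) * phi_term (i + 1) k) = phi_sum i n" for n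
      unfolding phi_step by (subst sum_lessThan_telescope) (simp add: phi_sum_def)
    then show "fps_X ^ n dvd (\<Sum>k<n. phi_term i k + fps_X ^ (i + 1) * phi_term (i + 1) k) - 1"
      \<comment> \<open>The value \<open>phi_sum i 0 = 0\<close> is harmless, since divisibility by
        q^0 is trivial.\<close>
      by (cases "n = 0") (simp_all add: phi_sum_cong_1 del: One_nat_def)
  qed
  then show ?thesis
    unfolding fps_suminf_add[OF phi_term_dvd *] fps_suminf_cmult[OF phi_term_dvd] .
qed

section \<open>The partial theta series and its functional equation\<close>

definition ptheta_term :: "nat \<Rightarrow> nat \<Rightarrow> laurent fps" where
  "ptheta_term i m = (-1) ^ m * fps_X ^ (m * (m + 1) div 2 + i * m)"

lemma ptheta_term_dvd: "fps_X ^ m dvd ptheta_term i m"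
proof -
  have "2 * m \<le> m * (m + 1)" by (cases m) auto
  then have "m \<le> m * (m + 1) div 2 + i * m" by linarith
  then show ?thesis
    unfolding ptheta_term_def by (intro dvd_mult le_imp_power_dvd)
qed

text \<open>The first term is 1. Passing from m to m + 1 raises the exponent by (i + 1) + m, so the
  remaining terms are -q^(i+1) times the series for i + 1.\<close>

lemma suminf_ptheta_term:
  "suminf (ptheta_term i) + fps_X ^ (i + 1) * suminf (ptheta_term (i + 1)) = 1"
proof -
  have "Suc m * (Suc m + 1) div 2 + i * Suc m = (i + 1) + (m * (m + 1) div 2 + (i + 1) * m)" for m
  proof -
    have "Suc m * (Suc m + 1) = m * (m + 1) + 2 * (m + 1)" by simp
    then show ?thesis by (simp add: algebra_simps)
  qed
  then have "ptheta_term i (Suc m) = - (fps_X ^ (i + 1)) * ptheta_term (i + 1) m" for m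
    unfolding ptheta_term_def by (simp only: power_add[of fps_X "i + 1"]) (simp add: mult_ac)
  then have "suminf (ptheta_term i) = 1 - fps_X ^ (i + 1) * suminf (ptheta_term (i + 1))"
    using fps_suminf_Suc[where f = "ptheta_term i", OF ptheta_term_dvd]
      fps_suminf_cmult[where f = "ptheta_term (i + 1)" and c = "- (fps_X ^ (i + 1))", OF ptheta_term_dvd]
    by (simp add: ptheta_term_def[of i 0])
  then show ?thesis by simp
qed

text \<open>Both series satisfy the same functional equation. Each application to their difference
  yields at least one more factor q, so the difference is divisible by every power of q.\<close>

lemma phi_eq_ptheta: "suminf (phi_term i) = suminf (ptheta_term i)"
proof -
  define d where "d i = suminf (phi_term i) - suminf (ptheta_term i)" for i
  have d_rec: "d i = - (fps_X ^ (i + 1)) * d (i + 1)" for i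
  proof -
    have "suminf (phi_term i) = 1 - fps_X ^ (i + 1) * suminf (phi_term (i + 1))"
      using suminf_phi_term[of i] by (simp only: eq_diff_eq)
    moreover have "suminf (ptheta_term i) = 1 - fps_X ^ (i + 1) * suminf (ptheta_term (i + 1))"
      using suminf_ptheta_term[of i] by (simp only: eq_diff_eq)
    ultimately show ?thesis
      unfolding d_def by (simp only: right_diff_distrib mult_minus_left) simp
  qed
  have "fps_X ^ n dvd d i" for n i
  proof (induction n arbitrary: i)
    case (Suc n)
    have "fps_X * fps_X ^ n dvd fps_X ^ (i + 1) * d (i + 1)"
      by (intro mult_dvd_mono Suc dvd_power) simp_all
    then show ?case by (subst d_rec) (simp only: mult_minus_left dvd_minus_iff power_Suc)
  qed simp
  then have "d i = 0" by (rule X_power_dvd_all_eq_0)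
  then show ?thesis by (simp add: d_def)
qed

section \<open>Coefficients of powers of z\<close>

text \<open>Laurent polynomials form the free abelian group on the exponents, so
  \<open>frag_induction\<close> reduces the index shift to a single monomial.\<close>

lemma lookup_single_mult:
  "Poly_Mapping.lookup (Poly_Mapping.single k 1 * f) j = Poly_Mapping.lookup (f :: laurent) (j - k)"
  using subset_UNIV[of "Poly_Mapping.keys f"]
proof (induction f rule: frag_induction[where S = UNIV])
  case (one l)
  show ?case
    by (auto simp: mult_single lookup_single when_def)
qed (simp_all add: right_diff_distrib lookup_minus)

text \<open>The coefficient of \<open>z\<^sup>j\<close>, again as an element of \<^typ>\<open>laurent fps\<close>, so that no separate ring
  of series in \<open>q\<close> is needed.\<close>

definition zcoef :: "int \<Rightarrow> laurent fps \<Rightarrow> laurent fps" where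
  "zcoef j F = Abs_fps (\<lambda>N. Poly_Mapping.single 0 (Poly_Mapping.lookup (F $ N) j))"

lemma zcoef_0 [simp]: "zcoef j 0 = 0"
  by (rule fps_ext) (simp add: zcoef_def)

lemma zcoef_add: "zcoef j (F + G) = zcoef j F + zcoef j G"
  by (rule fps_ext) (simp add: zcoef_def lookup_add single_add)

lemma zcoef_diff: "zcoef j (F - G) = zcoef j F - zcoef j G"
  by (rule fps_ext) (simp add: zcoef_def lookup_minus single_diff)

lemma zcoef_sum: "zcoef j (sum F A) = (\<Sum>a\<in>A. zcoef j (F a))"
  by (induction A rule: infinite_finite_induct) (simp_all add: zcoef_add)

lemma zcoef_zpow_mult: "zcoef j (zpow k * F) = zcoef (j - k) F"
  by (rule fps_ext) (simp add: zcoef_def zpow_def lookup_single_mult)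

lemma zcoef_1: "zcoef j 1 = (if j = 0 then 1 else 0)"
  by (rule fps_ext) (simp add: zcoef_def fps_one_nth lookup_one when_def)

lemma zpow_0 [simp]: "zpow 0 = 1"
  by (simp add: zpow_def)

lemma zpow_mult: "zpow k * zpow l = zpow (k + l)"
  by (simp add: zpow_def mult_single fps_const_mult)

lemma zcoef_zpow: "zcoef j (zpow k) = (if j = k then 1 else 0)"
  using zcoef_zpow_mult[of j k 1] by (simp add: zcoef_1)

lemma zcoef_eq_0_imp:
  assumes "\<And>j. zcoef j F = 0"
  shows "F = 0"
proof (rule fps_ext)
  fix N
  have "Poly_Mapping.lookup (F $ N) j = 0" for j
  proof -
    have "zcoef j F $ N = 0" by (simp add: assms)
    then show ?thesis
      by (metis zcoef_def fps_nth_Abs_fps lookup_single_eq lookup_zero)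
  qed
  then show "F $ N = 0 $ N"
    by (intro poly_mapping_eqI) simp
qed

lemma zcoef_X_mult: "zcoef j (fps_X * F) = fps_X * zcoef j F"
  by (rule fps_ext) (simp add: zcoef_def)

text \<open>The property characterises the series in \<open>q\<close> alone.\<close>

definition zfree :: "laurent fps \<Rightarrow> bool" where
  "zfree a \<longleftrightarrow> (\<forall>j F. zcoef j (a * F) = a * zcoef j F)"

lemma zcoef_mult: "zfree a \<Longrightarrow> zcoef j (a * F) = a * zcoef j F"
  by (simp add: zfree_def)

lemma zfree_0 [simp]: "zfree 0" and zfree_1 [simp]: "zfree 1" and zfree_X [simp]: "zfree fps_X"
  by (simp_all add: zfree_def zcoef_X_mult)

lemma zfree_add: "zfree a \<Longrightarrow> zfree b \<Longrightarrow> zfree (a + b)"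
  by (simp add: zfree_def distrib_right zcoef_add)

lemma zfree_diff: "zfree a \<Longrightarrow> zfree b \<Longrightarrow> zfree (a - b)"
  by (simp add: zfree_def left_diff_distrib zcoef_diff)

lemma zfree_uminus: "zfree a \<Longrightarrow> zfree (- a)"
  using zfree_diff[of 0 a] by simp

lemma zfree_mult: "zfree a \<Longrightarrow> zfree b \<Longrightarrow> zfree (a * b)"
  by (simp add: zfree_def mult.assoc)

lemma zfree_power: "zfree a \<Longrightarrow> zfree (a ^ n)"
  by (induction n) (simp_all add: zfree_mult)

lemma zfree_prod: "(\<And>i. i \<in> A \<Longrightarrow> zfree (f i)) \<Longrightarrow> zfree (prod f A)"
  by (induction A rule: infinite_finite_induct) (simp_all add: zfree_mult)

lemma zcoef_dvd: "fps_X ^ n dvd F \<Longrightarrow> fps_X ^ n dvd zcoef j F"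
  by (auto simp: dvd_def zcoef_mult zfree_power)

text \<open>Replacing \<open>a\<close> by \<open>b\<close> changes both sides of the defining
  equation by multiples of q^n only. This carries the property from finite to infinite
  products.\<close>

lemma zfree_limit:
  assumes "\<And>n. \<exists>b. zfree b \<and> fps_X ^ n dvd a - b"
  shows "zfree a"
  unfolding zfree_def
proof (intro allI)
  fix j F
  have "fps_X ^ n dvd zcoef j (a * F) - a * zcoef j F" for n
  proof -
    obtain b where b: "zfree b" "fps_X ^ n dvd a - b"
      using assms by blast
    have "zcoef j (a * F) - a * zcoef j F = zcoef j ((a - b) * F) - (a - b) * zcoef j F"
      by (simp add: left_diff_distrib zcoef_diff zcoef_mult[OF b(1)])
    with b(2) show ?thesis by (simp add: zcoef_dvd dvd_mult2)
  qed
  then have "zcoef j (a * F) - a * zcoef j F = 0"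
    by (rule X_power_dvd_all_eq_0)
  then show "zcoef j (a * F) = a * zcoef j F" by simp
qed

lemma zfree_qp:
  assumes "a > 0" "b > 0"
  shows "zfree (qp a b)"
proof (rule zfree_limit)
  fix n
  define P :: "laurent fps" where "P = (\<Prod>k<n. 1 - fps_X ^ a * (fps_X ^ b) ^ k)"
  have "qp a b = P * qp (a + b * n) b"
    unfolding qp_def P_def power_add power_mult using assms
    by (intro qpoch_inf_split) (simp_all add: X_dvd_iff)
  then have "qp a b - P = P * (qp (a + b * n) b - 1)"
    by (simp add: right_diff_distrib)
  moreover have "fps_X ^ n dvd qp (a + b * n) b - 1"
    using assms by (intro qp_cong_1) (auto intro: trans_le_add2)
  moreover have "zfree P"
    unfolding P_def by (intro zfree_prod zfree_diff zfree_mult zfree_power) simp_all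
  ultimately show "\<exists>b'. zfree b' \<and> fps_X ^ n dvd qp a b - b'"
    by (metis dvd_mult)
qed

lemma zcoef_suminf:
  assumes "\<And>n. fps_X ^ n dvd F n"
  shows "zcoef j (suminf F) = suminf (\<lambda>n. zcoef j (F n))"
proof (rule fps_ext)
  fix N
  have "zcoef j (suminf F) $ N = zcoef j (\<Sum>n\<le>N. F n) $ N"
    using fps_suminf_nth[of F N N, OF assms order_refl] by (simp add: zcoef_def fps_sum_nth)
  also have "\<dots> = suminf (\<lambda>n. zcoef j (F n)) $ N"
    using fps_suminf_nth[of "\<lambda>n. zcoef j (F n)" N N, OF zcoef_dvd[OF assms] order_refl]
    by (simp add: zcoef_sum fps_sum_nth)
  finally show "zcoef j (suminf F) $ N = suminf (\<lambda>n. zcoef j (F n)) $ N" .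
qed

text \<open>Divisibility by 1 - z stands in for vanishing at z = 1 and settles the coefficient of
  z^0. The quotient \<open>G\<close> has coefficients that are constant in j on each side of the gap
  between -1 and 0, and finite support makes both constants 0.\<close>

lemma zcoef_eq_0_if_dvd:
  assumes "1 - zpow 1 dvd F" and "\<And>j. j \<noteq> 0 \<Longrightarrow> zcoef j F = 0"
  shows "F = 0"
proof -
  obtain G where G: "F = (1 - zpow 1) * G"
    using assms(1) by (rule dvdE)
  have nth: "zcoef j F = zcoef j G - zcoef (j - 1) G" for j
    by (simp add: G left_diff_distrib zcoef_diff zcoef_zpow_mult)
  have "Poly_Mapping.lookup (G $ N) j = 0" for N j
  proof -
    define g where "g = Poly_Mapping.lookup (G $ N)"
    have step: "g j = g (j - 1)" if "j \<noteq> 0" for j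
    proof -
      have "zcoef j G $ N = zcoef (j - 1) G $ N"
        using nth[of j] assms(2)[OF that] by simp
      then show ?thesis
        by (metis g_def zcoef_def fps_nth_Abs_fps lookup_single_eq)
    qed
    have up: "g (int m) = g 0" for m
      by (induction m) (use step[of "int (Suc _)"] in auto)
    have down: "g (- 1 - int m) = g (- 1)" for m
    proof (induction m)
      case (Suc m)
      have "g (- 1 - int m) = g (- 1 - int m - 1)" by (rule step) simp
      also have "- 1 - int m - 1 = - 1 - int (Suc m)" by simp
      finally show ?case using Suc by simp
    qed simp
    have fin: "finite {j. g j \<noteq> 0}"
      by (simp add: g_def)
    have "g 0 = 0"
    proof (rule ccontr)
      assume "g 0 \<noteq> 0"
      then have "range int \<subseteq> {j. g j \<noteq> 0}" using up by auto
      then show False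
        using fin finite_subset finite_imageD[of int UNIV] by auto
    qed
    moreover have "g (- 1) = 0"
    proof (rule ccontr)
      assume "g (- 1) \<noteq> 0"
      then have "range (\<lambda>m. - 1 - int m) \<subseteq> {j. g j \<noteq> 0}" using down by auto
      then show False
        using fin finite_subset finite_imageD[of "\<lambda>m. - 1 - int m" UNIV] by (auto simp: inj_on_def)
    qed
    ultimately have "g j = 0"
      using up[of "nat j"] down[of "nat (- 1 - j)"] by (cases "j \<ge> 0") simp_all
    then show ?thesis by (simp add: g_def)
  qed
  then have "zcoef j G = 0" for j
    by (intro fps_ext) (simp add: zcoef_def)
  then have "G = 0" by (rule zcoef_eq_0_imp)
  with G show ?thesis by simp
qed

section \<open>The finite product\<close>

text \<open>This is (z;p)_n (1/z;p)_n, the part of the two infinite products that the denominator of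
  the n-th summand does not cancel.\<close>

definition zprod :: "nat \<Rightarrow> laurent fps" where
  "zprod n = (\<Prod>k<n. 1 - zpow 1 * fps_X ^ (2*k)) * (\<Prod>k<n. 1 - zpow (-1) * fps_X ^ (2*k))"

lemma zcoef_zprod_0: "zcoef j (zprod 0) = (if j = 0 then 1 else 0)"
  by (simp add: zprod_def zcoef_1)

text \<open>The two new factors multiply to 1 + P^2 - P (z + 1/z) with P = p^n, whence a three-term
  recurrence.\<close>

lemma zcoef_zprod_Suc:
  "zcoef j (zprod (Suc n)) = (1 + fps_X ^ (2*n) * fps_X ^ (2*n)) * zcoef j (zprod n) -
     fps_X ^ (2*n) * (zcoef (j - 1) (zprod n) + zcoef (j + 1) (zprod n))"
proof -
  define P :: "laurent fps" where "P = fps_X ^ (2*n)"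
  have P: "zfree P"
    unfolding P_def by (intro zfree_power zfree_X)
  have z: "zpow 1 * zpow (- 1) = 1"
    by (simp add: zpow_mult)
  have "zprod (Suc n) = zprod n * ((1 - zpow 1 * P) * (1 - zpow (-1) * P))"
    by (simp add: zprod_def P_def mult_ac)
  also have "(1 - zpow 1 * P) * (1 - zpow (-1) * P) =
      1 + (zpow 1 * zpow (-1)) * (P * P) - P * zpow 1 - P * zpow (-1)"
    by (simp add: algebra_simps)
  finally have eq: "zprod (Suc n) = (1 + P * P) * zprod n - P * (zpow 1 * zprod n) - P * (zpow (-1) * zprod n)"
    unfolding z by (simp add: algebra_simps)
  have P2: "zfree (1 + P * P)"
    by (intro zfree_add zfree_mult zfree_1 P)
  have "zcoef j (zprod (Suc n)) =
      (1 + P * P) * zcoef j (zprod n) - P * zcoef (j - 1) (zprod n) - P * zcoef (j + 1) (zprod n)"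
    unfolding eq by (simp add: zcoef_diff zcoef_mult[OF P] zcoef_mult[OF P2] zcoef_zpow_mult)
  then show ?thesis
    unfolding P_def[symmetric] by (simp add: algebra_simps)
qed

text \<open>The recurrence and its initial values are symmetric in j.\<close>

lemma zcoef_zprod_uminus: "zcoef (- j) (zprod n) = zcoef j (zprod n)"
proof (induction n arbitrary: j)
  case (Suc n)
  have e: "- j - 1 = - (j + 1)" "- j + 1 = - (j - 1)" by simp_all
  show ?case
    unfolding zcoef_zprod_Suc e Suc by (simp add: add.commute)
qed (simp add: zcoef_zprod_0)

section \<open>q-factorials, and tails of the infinite product in place of their reciprocals\<close>

definition qfact :: "nat \<Rightarrow> laurent fps" where
  "qfact n = (\<Prod>k=1..n. 1 - fps_X ^ (2*k))"

lemma qfact_Suc: "qfact (Suc n) = (1 - fps_X ^ (2*n + 2)) * qfact n"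
  by (simp add: qfact_def mult_ac)

definition qtail :: "nat \<Rightarrow> laurent fps" where
  "qtail n = qp (2*n + 2) 2"

lemma qtail_rec: "qtail n = (1 - fps_X ^ (2*n + 2)) * qtail (Suc n)"
  using qp_Suc[of "2*n + 2" 2] by (simp add: qtail_def)

lemma qtail_nonzero: "qtail n \<noteq> 0"
  by (simp add: qtail_def qp_nonzero)

lemma qfact_qtail: "qfact n * qtail n = qtail 0"
proof (induction n)
  case (Suc n)
  then show ?case
    by (simp add: qfact_Suc qtail_rec[of n] mult_ac)
qed (simp add: qfact_def)

definition qtail_diff :: "nat \<Rightarrow> nat \<Rightarrow> laurent fps" where
  "qtail_diff n j = (if j \<le> n then qtail (n - j) else 0)"

text \<open>At j = n the factor 1 - q^0 = 0 agrees with the value 0 assigned beyond n.\<close>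

lemma qtail_diff_Suc: "j \<le> n \<Longrightarrow> qtail_diff n (Suc j) = (1 - fps_X ^ (2 * (n - j))) * qtail_diff n j"
proof (cases "j = n")
  case False
  assume "j \<le> n"
  with False obtain d where "n = Suc (j + d)"
    using less_imp_Suc_add le_neq_implies_less by blast
  then show ?thesis
    using qtail_rec[of d] by (simp add: qtail_diff_def)
qed (simp add: qtail_diff_def)

lemma qtail_diff_Suc_Suc: "qtail_diff (Suc n) (Suc j) = qtail_diff n j"
  by (simp add: qtail_diff_def)

text \<open>The induction step of the finite triple product without its common factors: P = p^n, I =
  p^i and F = p^(n-j) with j = i + 1. The three inner terms come from the coefficients at j, j - 1
  and j + 1.\<close>

lemma zprod_step_identity:
  fixes p F I :: "'a::comm_ring_1"
  assumes "P = F * p * I"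
  shows "(1 + p*P) * ((1 + P*P) * (I * (1 + p*I) * (1 - p*F) * (1 - p*p*P*I)) +
      P * ((1 + I) * (1 - p*P*I) * (1 - p*p*P*I) + I*I*p * (1 + p*p*I) * (1 - F) * (1 - p*F))) =
    (1 + P) * (I * (1 + p*I) * (1 - p*P*P) * (1 - p*p*P*P))"
  unfolding assms by (simp add: algebra_simps)

text \<open>The finite triple product, cleared of denominators: \<^term>\<open>qtail n\<close> stands for \<open>qtail 0\<close> divided
  by \<^term>\<open>qfact n\<close>, and \<open>qtail_diff n j\<close> plays the role of \<open>1 / (p;p)\<close> with index \<open>n - j\<close>, which
  is \<open>0\<close> for \<open>j > n\<close>.\<close>

lemma zcoef_zprod:
  "qtail 0 * qtail 0 * zcoef (int j) (zprod n) * (1 + fps_X ^ (2*n)) =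
   (-1) ^ j * fps_X ^ (j * (j - 1)) * (1 + fps_X ^ (2*j)) * qfact (2*n) * qtail_diff n j * qtail (n + j)"
proof (induction n arbitrary: j)
  case 0
  show ?case
    by (auto simp: zcoef_zprod_0 qtail_diff_def qfact_def)
next
  case (Suc n)
  define P p :: "laurent fps" where "P = fps_X ^ (2*n)" and "p = fps_X ^ 2"
  define D where "D = qfact (2*n)"
  define c where "c j = qtail 0 * qtail 0 * zcoef j (zprod n)" for j
  have IH: "c (int j) * (1 + P) =
      (-1) ^ j * fps_X ^ (j * (j - 1)) * (1 + fps_X ^ (2*j)) * D * qtail_diff n j * qtail (n + j)" for j
    using Suc[of j] by (simp add: c_def P_def D_def)
  have pw: "fps_X ^ (2*n + 2) = p * P" "fps_X ^ (2 * (2*n) + 2) = p * P * P"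
      "fps_X ^ (2 * (2*n + 1) + 2) = p * p * P * P" "fps_X ^ (2 * Suc n) = p * P"
    unfolding p_def P_def power_add[symmetric] by (rule arg_cong[where f = "(^) fps_X"]; simp)+
  have D: "qfact (2 * Suc n) = (1 - p * P * P) * (1 - p * p * P * P) * D"
    using qfact_Suc[of "2*n + 1"] qfact_Suc[of "2*n"] pw(2,3) by (simp add: D_def mult_ac)
  have P1: "1 + P \<noteq> 0"
    by (simp add: P_def one_plus_X_power_nonzero)
  have step: "qtail 0 * qtail 0 * zcoef j (zprod (Suc n)) = (1 + P * P) * c j - P * (c (j - 1) + c (j + 1))" for j
    by (simp add: zcoef_zprod_Suc c_def P_def algebra_simps)
  \<comment> \<open>The induction hypothesis determines the values of \<open>c\<close> only after
    multiplication by 1 + P.\<close>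
  have "(1 + P) * (qtail 0 * qtail 0 * zcoef (int j) (zprod (Suc n)) * (1 + p * P)) =
      (1 + P) * ((-1) ^ j * fps_X ^ (j * (j - 1)) * (1 + fps_X ^ (2*j)) *
        ((1 - p * P * P) * (1 - p * p * P * P) * D) * qtail_diff (Suc n) j * qtail (Suc n + j))"
  proof (cases j)
    case 0
    define a where "a = qtail (Suc n)"
    \<comment> \<open>The induction hypothesis covers nonnegative indices only; symmetry supplies
      the index -1.\<close>
    have "c (- 1) = c 1"
      by (simp add: c_def zcoef_zprod_uminus)
    moreover have qn: "qtail n = (1 - p * P) * a"
      by (simp add: a_def qtail_rec[of n] flip: pw(1))
    moreover have "qtail_diff n 1 = (1 - P) * qtail n"
      using qtail_diff_Suc[of 0 n] by (simp add: qtail_diff_def P_def)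
    ultimately have c0: "c 0 * (1 + P) = 2 * D * ((1 - p * P) * a) * ((1 - p * P) * a)"
      and c1: "c 1 * (1 + P) = - (1 + p) * D * ((1 - P) * ((1 - p * P) * a)) * a"
      using IH[of 0] IH[of 1] by (simp_all add: qtail_diff_def a_def p_def)
    have "(1 + P) * (((1 + P * P) * c 0 - P * (c (- 1) + c 1)) * (1 + p * P)) =
        (1 + p * P) * ((1 + P * P) * (c 0 * (1 + P)) - 2 * P * (c 1 * (1 + P)))"
      unfolding \<open>c (- 1) = c 1\<close> by (simp add: algebra_simps)
    also have "\<dots> = (1 + P) * (2 * ((1 - p * P * P) * (1 - p * p * P * P) * D) * a * a)"
      unfolding c0 c1 by (simp add: algebra_simps)
    finally show ?thesis
      using 0 step[of 0] by (simp add: qtail_diff_def a_def)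
  next
    case j: (Suc i)
    define I W :: "laurent fps" where "I = fps_X ^ (2*i)" and "W = fps_X ^ (i * (i - 1))"
    define s :: "laurent fps" where "s = (-1) ^ i"
    define b where "b = qtail (Suc n + j)"
    have e1: "fps_X ^ (j * (j - 1)) = W * I"
      unfolding W_def I_def j power_add[symmetric]
      by (rule arg_cong[where f = "(^) fps_X"]) (cases i, simp_all add: algebra_simps)
    have e2: "fps_X ^ (Suc j * (Suc j - 1)) = W * I * I * p"
      unfolding W_def I_def p_def j power_add[symmetric]
      by (rule arg_cong[where f = "(^) fps_X"]) (cases i, simp_all add: algebra_simps)
    have e3: "fps_X ^ (2 * j) = p * I" "fps_X ^ (2 * Suc j) = p * p * I"
      by (simp_all add: j I_def p_def power_add power2_eq_square mult_ac)
    have b1: "qtail (n + j) = (1 - p * p * P * I) * b"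
      using qtail_rec[of "n + j"]
      by (simp add: b_def j I_def p_def P_def power_add power2_eq_square mult_ac)
    have b0: "qtail (n + i) = (1 - p * P * I) * ((1 - p * p * P * I) * b)"
      using qtail_rec[of "n + i"] unfolding b1[symmetric]
      by (simp add: j I_def p_def P_def power_add power2_eq_square mult_ac)
    have ind: "int j - 1 = int i" "int j + 1 = int (Suc j)"
      by (simp_all add: j)
    have main: "(1 + P) * (qtail 0 * qtail 0 * zcoef (int j) (zprod (Suc n)) * (1 + p * P)) =
       (1 + p * P) * ((1 + P * P) * (c (int j) * (1 + P)) - P * (c (int i) * (1 + P) + c (int (Suc j)) * (1 + P)))"
      unfolding step ind by (simp add: algebra_simps)
    \<comment> \<open>At j = n the upper neighbour vanishes through 1 - F = 0, so the generic case
      includes it. At j = n + 1 only the lower neighbour survives, and beyond that nothing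
      does.\<close>
    consider "j \<le> n" | "j = Suc n" | "j > Suc n" by linarith
    then show ?thesis
    proof cases
      case 1
      define F :: "laurent fps" where "F = fps_X ^ (2 * (n - j))"
      define a where "a = qtail_diff n i"
      have "n = (n - j) + 1 + i" using 1 j by simp
      then have PF: "P = F * p * I"
        unfolding P_def F_def p_def I_def power_add[symmetric] by (intro arg_cong[where f = "(^) fps_X"]) linarith
      have pF: "fps_X ^ (2 * (n - i)) = p * F"
        unfolding F_def p_def power_add[symmetric]
        by (rule arg_cong[where f = "(^) fps_X"]) (use 1 j in linarith)
      have a1: "qtail_diff n j = (1 - p * F) * a"
        using qtail_diff_Suc[of i n] 1 by (simp add: j a_def pF)
      have a2: "qtail_diff n (Suc j) = (1 - F) * ((1 - p * F) * a)"
        using qtail_diff_Suc[OF 1] unfolding a1 F_def[symmetric] .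
      have cj: "c (int j) * (1 + P) = - s * (W * D * a * b) * (I * (1 + p*I) * (1 - p*F) * (1 - p*p*P*I))"
        unfolding IH[of j] e1 e3 a1 b1 by (simp add: j s_def mult_ac)
      have ci: "c (int i) * (1 + P) = s * (W * D * a * b) * ((1 + I) * (1 - p*P*I) * (1 - p*p*P*I))"
        unfolding IH[of i] b0 by (simp add: W_def I_def s_def a_def mult_ac)
      have ck: "c (int (Suc j)) * (1 + P) = s * (W * D * a * b) * (I*I*p * (1 + p*p*I) * (1 - F) * (1 - p*F))"
        unfolding IH[of "Suc j"] e2 e3 a2 by (simp add: j s_def b_def mult_ac)
      have "(1 + P) * (qtail 0 * qtail 0 * zcoef (int j) (zprod (Suc n)) * (1 + p * P)) =
         - s * (W * D * a * b) * ((1 + p*P) * ((1 + P*P) * (I * (1 + p*I) * (1 - p*F) * (1 - p*p*P*I)) +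
      P * ((1 + I) * (1 - p*P*I) * (1 - p*p*P*I) + I*I*p * (1 + p*p*I) * (1 - F) * (1 - p*F))))"
        unfolding main cj ci ck by algebra
      also have "\<dots> = - s * (W * D * a * b) * ((1 + P) * (I * (1 + p*I) * (1 - p*P*P) * (1 - p*p*P*P)))"
        unfolding zprod_step_identity[OF PF] ..
      also have "\<dots> = (1 + P) * ((-1) ^ j * (W * I) * (1 + p * I) *
          ((1 - p * P * P) * (1 - p * p * P * P) * D) * qtail_diff (Suc n) j * b)"
        by (simp add: j s_def a_def qtail_diff_Suc_Suc mult_ac)
      finally show ?thesis
        unfolding e1 e3 b_def .
    next
      case 2
      then have i: "i = n" using j by simp
      have IP: "I = P" by (simp add: I_def P_def i)
      have cj: "c (int j) * (1 + P) = 0" "c (int (Suc j)) * (1 + P) = 0"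
        unfolding IH by (simp_all add: 2 qtail_diff_def)
      have ci: "c (int i) * (1 + P) = s * W * (1 + P) * D * qtail 0 * ((1 - p * P * P) * ((1 - p * p * P * P) * b))"
        unfolding IH[of i] b0 IP by (simp add: W_def s_def qtail_diff_def i P_def)
      show ?thesis
        unfolding main cj ci e1 e3 b_def[symmetric] IP
        by (simp add: j i s_def qtail_diff_def mult_ac)
    next
      case 3
      then have z: "c (int j) * (1 + P) = 0" "c (int i) * (1 + P) = 0" "c (int (Suc j)) * (1 + P) = 0"
        unfolding IH using j by (simp_all add: qtail_diff_def)
      with 3 show ?thesis
        unfolding main z by (simp add: qtail_diff_def)
    qed
  qed
  with P1 show ?case
    unfolding D pw(4) by simp
qed

lemma zcoef_zprod_eq_0: "n < j \<Longrightarrow> zcoef (int j) (zprod n) = 0"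
  using zcoef_zprod[of j n] qtail_nonzero[of 0] one_plus_X_power_nonzero[of "2*n"]
  by (simp add: qtail_diff_def)

text \<open>In 1 - q^(2(m+k+1)) = (1 - x)(1 + x) with x = q^(m+k+1), the factor 1 - x is absorbed by
  \<open>qp\<close> and 1 + x joins the product.\<close>

lemma qfact_add:
  "qp (m + k + 1) 1 * qfact (m + k) * qtail m = qtail 0 * qp (m + 1) 1 * (\<Prod>s=1..k. 1 + fps_X ^ (m + s))"
proof (induction k)
  case 0
  show ?case by (simp add: mult_ac flip: qfact_qtail[of m])
next
  case (Suc k)
  define x :: "laurent fps" where "x = fps_X ^ (m + k + 1)"
  have x2: "fps_X ^ (2 * (m + k) + 2) = x * x"
    unfolding x_def power_add[symmetric] by (rule arg_cong[where f = "(^) fps_X"]) simp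
  have "qp (m + k + 1) 1 = (1 - x) * qp (m + Suc k + 1) 1"
    using qp_Suc[of "m + k + 1" 1] by (simp add: x_def)
  with Suc have "(1 + x) * ((1 - x) * qp (m + Suc k + 1) 1 * qfact (m + k) * qtail m) =
      qtail 0 * qp (m + 1) 1 * ((\<Prod>s=1..k. 1 + fps_X ^ (m + s)) * (1 + x))"
    by (simp add: mult_ac)
  moreover have "qfact (m + Suc k) = (1 + x) * (1 - x) * qfact (m + k)"
    using qfact_Suc[of "m + k"] unfolding x2 by (simp add: algebra_simps)
  ultimately show ?case
    by (simp add: x_def mult_ac)
qed

text \<open>With n = J + k, the finite triple product is inserted and \<open>qfact_add\<close> at m
  = 2J + k removes the q-factorial.\<close>

lemma zcoef_zprod_phi_term:
  assumes "J > 0"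
  shows "fps_X ^ (2 * (J + k)) * qp (2 * (J + k) + 1) 1 * qp 2 2 * zcoef (int J) (zprod (J + k)) =
    (-1) ^ J * fps_X ^ (J * J + J) * phi_term (2 * J) k"
proof -
  define n where "n = J + k"
  define Z where "Z = zcoef (int J) (zprod n)"
  define V :: "laurent fps" where "V = (\<Prod>s=1..k. 1 + fps_X ^ (2*J + k + s))"
  have n: "2 * J + k + k = 2 * n" "n + J = 2 * J + k" by (simp_all add: n_def)
  \<comment> \<open>The factor 1 + q^(2n) completes the product for k > 0 and equals 1 + q^(2J) for
    k = 0, which removes the case distinction in \<open>phi_term\<close>.\<close>
  have T: "(1 + fps_X ^ (2*n)) * phi_term (2*J) k =
      (1 + fps_X ^ (2*J)) * fps_X ^ (2*k) * qtail k * qp (2*J + k + 1) 1 * V"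
  proof (cases "k = 0")
    case False
    then have "V = (\<Prod>s=1..<k. 1 + fps_X ^ (2*J + k + s)) * (1 + fps_X ^ (2*n))"
      unfolding V_def n(1)[symmetric]
      by (simp add: prod.last_plus flip: atLeastLessThanSuc_atLeastAtMost)
    with False show ?thesis
      by (simp add: phi_term_def qtail_def mult_ac)
  qed (simp add: phi_term_def n_def V_def qtail_def)
  have ex: "fps_X ^ (2*n) * fps_X ^ (J * (J - 1)) = fps_X ^ (J * J + J) * (fps_X ^ (2*k) :: laurent fps)"
    unfolding power_add[symmetric]
    by (rule arg_cong[where f = "(^) fps_X"]) (cases J, simp_all add: n_def algebra_simps)
  have "qtail 0 * (1 + fps_X ^ (2*n)) * (fps_X ^ (2*n) * qp (2*n + 1) 1 * qtail 0 * Z) =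
      fps_X ^ (2*n) * qp (2*n + 1) 1 * (qtail 0 * qtail 0 * Z * (1 + fps_X ^ (2*n)))"
    by (simp add: mult_ac)
  also have "\<dots> = (-1) ^ J * (fps_X ^ (2*n) * fps_X ^ (J * (J - 1))) * (1 + fps_X ^ (2*J)) * qtail k *
      (qp (2*J + k + k + 1) 1 * qfact (2*J + k + k) * qtail (2*J + k))"
    unfolding Z_def zcoef_zprod n by (simp add: qtail_diff_def n_def mult_ac)
  also have "\<dots> = qtail 0 * ((-1) ^ J * fps_X ^ (J * J + J) * ((1 + fps_X ^ (2*n)) * phi_term (2*J) k))"
    unfolding ex T qfact_add V_def by (simp add: mult_ac)
  finally have "qtail 0 * (1 + fps_X ^ (2*n)) * (fps_X ^ (2*n) * qp (2*n + 1) 1 * qtail 0 * Z) =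
      qtail 0 * (1 + fps_X ^ (2*n)) * ((-1) ^ J * fps_X ^ (J * J + J) * phi_term (2*J) k)"
    by (simp add: mult_ac)
  then have "fps_X ^ (2*n) * qp (2*n + 1) 1 * qtail 0 * Z = (-1) ^ J * fps_X ^ (J * J + J) * phi_term (2*J) k"
    using qtail_nonzero[of 0] one_plus_X_power_nonzero[of "2*n"] by simp
  then show ?thesis
    by (simp add: n_def Z_def qtail_def numeral_2_eq_2)
qed

section \<open>The double sum\<close>

text \<open>The difference d of the two sides satisfies d m = (1 - q^m) d (m + 1), so d m is a
  multiple of d (m + n). The latter is divisible by q^(m+n), both of its terms being 1 modulo that
  power.\<close>

lemma qp_even_odd:
  assumes "m > 0"
  shows "qp m 2 * qp (m + 1) 2 = qp m 1"
proof -
  define d where "d m = qp m 2 * qp (m + 1) 2 - qp m 1" for m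
  have d_rec: "d m = (1 - fps_X ^ m) * d (m + 1)" if "m > 0" for m
  proof -
    have e: "qp m 2 = (1 - fps_X ^ m) * qp (m + 2) 2" "qp m 1 = (1 - fps_X ^ m) * qp (m + 1) 1"
      by (rule qp_Suc; simp add: that)+
    show ?thesis
      unfolding d_def e by (simp add: algebra_simps)
  qed
  have "fps_X ^ n dvd d m" if "m > 0" for n m
  proof -
    have *: "fps_X ^ k dvd d k" if "k > 0" for k
    proof -
      have "d k = (qp k 2 * qp (k + 1) 2 - 1) - (qp k 1 - 1)"
        by (simp add: d_def)
      with that show ?thesis
        by (simp only:) (intro dvd_diff dvd_mult_minus_1 qp_cong_1; simp)
    qed
    have "d (m + n) dvd d m"
    proof (induction n)
      case (Suc n)
      have "d (m + Suc n) dvd d (m + n)"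
        using d_rec[of "m + n"] that by simp
      from this Suc show ?case by (rule dvd_trans)
    qed simp
    moreover have "fps_X ^ n dvd d (m + n)"
      using *[of "m + n"] that by (intro X_power_dvd_mono[of n "m + n"]) simp_all
    ultimately show ?thesis by (rule dvd_trans[rotated])
  qed
  then have "d m = 0"
    using assms by (intro X_power_dvd_all_eq_0)
  then show ?thesis by (simp add: d_def)
qed

section \<open>The coefficients of the left-hand side\<close>

definition S2_summand :: "nat \<Rightarrow> laurent fps" where
  "S2_summand n = fps_X ^ (2*n) * qp (2*n + 1) 1 * qp 2 2 * zprod n"

lemma S2_summand_dvd: "fps_X ^ n dvd S2_summand n"
proof -
  have "fps_X ^ n dvd (fps_X ^ (2*n) :: laurent fps)"
    by (rule le_imp_power_dvd) simp
  then show ?thesis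
    unfolding S2_summand_def by (intro dvd_mult2)
qed

lemma S2_term_dvd: "fps_X ^ n dvd S2_term (- fps_X) n"
proof -
  have "fps_X ^ n dvd ((- fps_X) ^ (2*n) :: laurent fps)"
    by (simp add: le_imp_power_dvd)
  then show ?thesis
    unfolding S2_term_def by (intro dvd_mult2)
qed

lemma zpow_nth_0: "zpow k $ 0 = Poly_Mapping.single k 1"
  by (simp add: zpow_def)

lemma zpow_nth_0_neq_1: "k \<noteq> 0 \<Longrightarrow> zpow k $ 0 \<noteq> 1"
  unfolding zpow_nth_0 by (metis lookup_one lookup_single_eq when_simps(2) zero_neq_one)

text \<open>Splitting n factors off (z;p) and (1/z;p) leaves exactly the denominator of the summand;
  the two remaining products in the numerator merge by \<open>qp_even_odd\<close>.\<close>

lemma S2_term_eq: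
  assumes "n > 0"
  shows "qpoch_inf (zpow 1) (fps_X\<^sup>2) * qpoch_inf (zpow (-1)) (fps_X\<^sup>2) * qpoch_inf (fps_X\<^sup>2) (fps_X\<^sup>2) *
    S2_term (- fps_X) n = S2_summand n"
proof -
  define Z where "Z k = qpoch_inf (zpow k * fps_X ^ (2*n)) (fps_X\<^sup>2)" for k
  have split: "qpoch_inf (zpow k) (fps_X\<^sup>2) = (\<Prod>i<n. 1 - zpow k * fps_X ^ (2*i)) * Z k" if "k \<noteq> 0" for k
    unfolding Z_def power_mult
    by (rule qpoch_inf_split) (simp_all add: X_dvd_iff zpow_nth_0_neq_1 that)
  \<comment> \<open>This justifies the second argument 1 of \<open>fps_right_inverse\<close>; n > 0
    makes q divide the first argument of \<open>qpoch_inf\<close>.\<close>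
  have Z0: "Z k $ 0 = 1" for k
  proof -
    have "fps_X ^ 1 dvd Z k - 1"
      unfolding Z_def using assms
      by (intro qpoch_inf_cong_1) (simp_all add: X_dvd_iff)
    then have "(Z k - 1) $ 0 = 0" by (rule X_power_dvd_nth[rotated]) simp
    then show ?thesis by simp
  qed
  have inv: "Z 1 * Z (-1) * fps_right_inverse (Z 1 * Z (-1)) 1 = 1"
    by (rule fps_right_inverse) (simp add: Z0)
  have neg: "(- fps_X :: laurent fps)\<^sup>2 = fps_X\<^sup>2" "(- fps_X :: laurent fps) ^ (2*n) = fps_X ^ (2*n)"
      "(- fps_X :: laurent fps) ^ (2*n + 2) = fps_X ^ (2*n + 2)"
      "- ((- fps_X :: laurent fps) ^ (2*n + 1)) = fps_X ^ (2*n + 1)"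
    by simp_all
  have S: "S2_term (- fps_X) n = fps_X ^ (2*n) * qp (2*n + 1) 1 * fps_right_inverse (Z 1 * Z (-1)) 1"
    unfolding S2_term_def neg
    using qp_even_odd[of "2*n + 1"] by (simp add: qp_def Z_def mult_ac)
  have "qpoch_inf (zpow 1) (fps_X\<^sup>2) * qpoch_inf (zpow (-1)) (fps_X\<^sup>2) * qpoch_inf (fps_X\<^sup>2) (fps_X\<^sup>2) *
      S2_term (- fps_X) n = S2_summand n * (Z 1 * Z (-1) * fps_right_inverse (Z 1 * Z (-1)) 1)"
    unfolding S by (simp add: split S2_summand_def zprod_def qp_def mult_ac)
  then show ?thesis
    unfolding inv by simp
qed

lemma zcoef_S2:
  assumes "j \<noteq> 0" "J = nat \<bar>j\<bar>"
  shows "zcoef j (qpoch_inf (zpow 1) (fps_X\<^sup>2) * qpoch_inf (zpow (-1)) (fps_X\<^sup>2) *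
      qpoch_inf (fps_X\<^sup>2) (fps_X\<^sup>2) * S2 (- fps_X)) =
    (-1) ^ J * fps_X ^ (J * J + J) * suminf (ptheta_term (2 * J))" (is "zcoef j (?C * _) = ?R")
proof -
  have J: "J > 0" using assms by simp
  define f where "f n = zcoef j (S2_summand n)" for n
  have f: "f n = fps_X ^ (2*n) * qp (2*n + 1) 1 * qp 2 2 * zcoef (int J) (zprod n)" for n
  proof -
    have "zfree (fps_X ^ (2*n) * qp (2*n + 1) 1 * qp 2 2)"
      by (intro zfree_mult zfree_power zfree_X zfree_qp) simp_all
    moreover have "zcoef j (zprod n) = zcoef (int J) (zprod n)"
      using assms(2) zcoef_zprod_uminus[of "int J" n] by (cases "j \<ge> 0") simp_all
    ultimately show ?thesis
      unfolding f_def S2_summand_def by (simp add: zcoef_mult)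
  qed
  have f_dvd: "fps_X ^ n dvd f n" for n
    unfolding f_def by (intro zcoef_dvd S2_summand_dvd)
  have dvd: "fps_X ^ n dvd S2_term (- fps_X) (Suc n)" "fps_X ^ n dvd S2_summand (Suc n)" for n
    by (rule X_power_dvd_mono[OF _ S2_term_dvd] X_power_dvd_mono[OF _ S2_summand_dvd]; simp)+
  have "?C * S2 (- fps_X) = suminf (\<lambda>n. ?C * S2_term (- fps_X) (Suc n))"
    unfolding S2_def by (rule fps_suminf_cmult[symmetric]) (rule dvd)
  also have "\<dots> = suminf (\<lambda>n. S2_summand (Suc n))"
    by (simp only: S2_term_eq zero_less_Suc)
  finally have "zcoef j (?C * S2 (- fps_X)) = suminf (\<lambda>n. f (Suc n))"
    unfolding f_def by (simp only: zcoef_suminf[OF dvd(2)])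
  \<comment> \<open>The summand n = 0 may be added because \<open>zprod 0\<close> is 1 and J >
    0.\<close>
  also have "\<dots> = suminf f"
    using fps_suminf_Suc[where f = f, OF f_dvd] J by (simp add: f zcoef_zprod_0)
  \<comment> \<open>Summands with n < J vanish: no power of z beyond z^n occurs in
    \<open>zprod n\<close>.\<close>
  also have "\<dots> = suminf (\<lambda>k. f (J + k))"
    by (intro fps_suminf_shift f_dvd) (simp add: f zcoef_zprod_eq_0)
  also have "\<dots> = suminf (\<lambda>k. (-1) ^ J * fps_X ^ (J * J + J) * phi_term (2 * J) k)"
    by (simp only: f zcoef_zprod_phi_term[OF J])
  also have "\<dots> = ?R"
    by (simp only: fps_suminf_cmult[OF phi_term_dvd] phi_eq_ptheta)
  finally show ?thesis .
qed

section \<open>The coefficients of the double sum\<close>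

definition hecke_exp :: "nat \<Rightarrow> nat \<Rightarrow> nat" where
  "hecke_exp n m = ((2*n\<^sup>2 - m\<^sup>2) + (2*n - m)) div 2"

text \<open>For n = J + k the numerator is k(k + 1) plus an even number, so the division is exact.
  The two parts are the exponents of the prefactor and of
  \<open>ptheta_term (2 * J) k\<close>.\<close>

lemma hecke_exp_shift: "hecke_exp (J + k) k = (J * J + J) + (k * (k + 1) div 2 + 2 * J * k)"
proof -
  have "2 * (J + k)\<^sup>2 - k\<^sup>2 + (2 * (J + k) - k) = k * (k + 1) + 2 * (J * J + J + 2 * J * k)"
    by (simp add: power2_eq_square algebra_simps)
  then show ?thesis
    by (simp add: hecke_exp_def)
qed

lemma hecke_exp_ge: "m \<le> n \<Longrightarrow> n \<le> hecke_exp n m"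
proof -
  assume "m \<le> n"
  then obtain J where n: "n = J + m"
    by (metis add.commute le_Suc_ex)
  have "2 * m \<le> m * (m + 1)" by (cases m) auto
  then have "m \<le> m * (m + 1) div 2" by linarith
  then show ?thesis unfolding n hecke_exp_shift by linarith
qed

definition hecke_summand :: "nat \<Rightarrow> laurent fps" where
  "hecke_summand n = (\<Sum>m=0..n. (-1) ^ n * (1 - zpow (int n - int m))\<^sup>2 * zpow (int m - int n) *
    fps_X ^ hecke_exp n m)"

lemma hecke_summand_dvd: "fps_X ^ n dvd hecke_summand n"
  unfolding hecke_summand_def
  by (intro dvd_sum dvd_mult le_imp_power_dvd hecke_exp_ge) simp

text \<open>The product is z^d - 2 + z^(-d).\<close>

lemma zcoef_square:
  assumes "j \<noteq> 0" "d \<ge> 0"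
  shows "zcoef j ((1 - zpow d)\<^sup>2 * zpow (- d)) = (if d = \<bar>j\<bar> then 1 else 0)"
proof -
  have "(1 - zpow d)\<^sup>2 * zpow (- d) = zpow (- d) - 2 * (zpow d * zpow (- d)) + zpow d * (zpow d * zpow (- d))"
    by (simp add: power2_eq_square algebra_simps)
  also have "\<dots> = zpow (- d) - (1 + 1) + zpow d"
    by (simp add: zpow_mult)
  finally have eq: "(1 - zpow d)\<^sup>2 * zpow (- d) = zpow (- d) - (1 + 1) + zpow d" .
  show ?thesis
    unfolding eq zcoef_diff zcoef_add zcoef_zpow zcoef_1 using assms by auto
qed

text \<open>For fixed n only m = n - J contributes, so the double sum collapses to a sum over k = m
  with n = J + k.\<close>

lemma zcoef_hecke:
  assumes "j \<noteq> 0" "J = nat \<bar>j\<bar>"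
  shows "zcoef j (suminf hecke_summand) = (-1) ^ J * fps_X ^ (J * J + J) * suminf (ptheta_term (2 * J))"
proof -
  define f where "f n = zcoef j (hecke_summand n)" for n
  have f: "f n = (\<Sum>m=0..n. if m + J = n then (-1) ^ n * fps_X ^ hecke_exp n m else 0)" for n
    unfolding f_def hecke_summand_def zcoef_sum
  proof (rule sum.cong[OF refl])
    fix m assume "m \<in> {0..n}"
    have zf: "zfree ((-1) ^ n * fps_X ^ hecke_exp n m)"
      by (intro zfree_mult zfree_power zfree_uminus zfree_1 zfree_X)
    have "zcoef j ((-1) ^ n * (1 - zpow (int n - int m))\<^sup>2 * zpow (int m - int n) * fps_X ^ hecke_exp n m) =
        ((-1) ^ n * fps_X ^ hecke_exp n m) * zcoef j ((1 - zpow (int n - int m))\<^sup>2 * zpow (- (int n - int m)))"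
      unfolding zcoef_mult[OF zf, symmetric] by (simp add: mult_ac)
    also have "\<dots> = (if m + J = n then (-1) ^ n * fps_X ^ hecke_exp n m else 0)"
      using \<open>m \<in> {0..n}\<close> assms by (subst zcoef_square) auto
    finally show "zcoef j ((-1) ^ n * (1 - zpow (int n - int m))\<^sup>2 * zpow (int m - int n) * fps_X ^ hecke_exp n m) =
      (if m + J = n then (-1) ^ n * fps_X ^ hecke_exp n m else 0)" .
  qed
  have f_shift: "f (J + k) = (-1) ^ J * fps_X ^ (J * J + J) * ptheta_term (2 * J) k" for k
  proof -
    have "f (J + k) = (-1) ^ (J + k) * fps_X ^ hecke_exp (J + k) k"
      unfolding f by (subst sum.mono_neutral_right[of _ "{k}"]) auto
    then show ?thesis
      unfolding hecke_exp_shift power_add ptheta_term_def by (simp add: mult_ac)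
  qed
  have "zcoef j (suminf hecke_summand) = suminf f"
    unfolding f_def by (rule zcoef_suminf[OF hecke_summand_dvd])
  also have "\<dots> = suminf (\<lambda>k. f (J + k))"
  proof (rule fps_suminf_shift)
    show "fps_X ^ n dvd f n" for n
      unfolding f_def by (intro zcoef_dvd hecke_summand_dvd)
    show "f n = 0" if "n < J" for n
      unfolding f using that by (intro sum.neutral) auto
  qed
  finally show ?thesis
    unfolding f_shift fps_suminf_cmult[OF ptheta_term_dvd] .
qed

lemma one_minus_zpow_dvd: "1 - zpow 1 dvd 1 - zpow (int d)"
proof (induction d)
  case (Suc d)
  have "1 - zpow (int (Suc d)) = (1 - zpow 1) + zpow 1 * (1 - zpow (int d))"
    by (simp add: right_diff_distrib zpow_mult)
  with Suc show ?case by (metis dvd_add dvd_mult dvd_refl)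
qed simp

text \<open>One of the two factors 1 - z^(n-m) is divided by 1 - z in each summand. The powers of q
  stay, so the series of quotients \<open>h\<close> still converges.\<close>

lemma dvd_suminf_hecke: "1 - zpow 1 dvd suminf hecke_summand"
proof -
  define g where "g d = (SOME c. 1 - zpow (int d) = (1 - zpow 1) * c)" for d
  have g: "1 - zpow (int d) = (1 - zpow 1) * g d" for d
    using one_minus_zpow_dvd[of d] unfolding g_def dvd_def by (rule someI_ex)
  define h where "h n = (\<Sum>m=0..n. (-1) ^ n * (g (n - m) * (1 - zpow (int n - int m)) *
      zpow (int m - int n)) * fps_X ^ hecke_exp n m)" for n
  have hs: "hecke_summand n = (1 - zpow 1) * h n" for n
    unfolding hecke_summand_def h_def sum_distrib_left
  proof (rule sum.cong[OF refl])
    fix m assume "m \<in> {0..n}"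
    then have "int n - int m = int (n - m)" by simp
    then show "(-1) ^ n * (1 - zpow (int n - int m))\<^sup>2 * zpow (int m - int n) * fps_X ^ hecke_exp n m =
      (1 - zpow 1) * ((-1) ^ n * (g (n - m) * (1 - zpow (int n - int m)) * zpow (int m - int n)) * fps_X ^ hecke_exp n m)"
      using g[of "n - m"] by (simp only: power2_eq_square mult_ac)
  qed
  have "fps_X ^ n dvd h n" for n
    unfolding h_def by (intro dvd_sum dvd_mult le_imp_power_dvd hecke_exp_ge) simp
  then have "suminf hecke_summand = (1 - zpow 1) * suminf h"
    unfolding hs[abs_def] by (rule fps_suminf_cmult)
  then show ?thesis by simp
qed

theorem theorem6p3:
  shows "qpoch_inf (zpow 1) (fps_X\<^sup>2) * qpoch_inf (zpow (-1)) (fps_X\<^sup>2) *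
      qpoch_inf (fps_X\<^sup>2) (fps_X\<^sup>2) * S2 (- fps_X) =
    suminf (\<lambda>n. \<Sum>m=0..n. (-1) ^ n * (1 - zpow (int n - int m))\<^sup>2 * zpow (int m - int n) *
      fps_X ^ (((2*n\<^sup>2 - m\<^sup>2) + (2*n - m)) div 2))"
    (is "?L = suminf ?f")
proof -
  have f: "?f = hecke_summand"
    by (simp add: fun_eq_iff hecke_summand_def hecke_exp_def)
  \<comment> \<open>The first factor of (z;p) is 1 - z, so both sides are divisible by it and only
    the coefficients of z^j with nonzero j remain to be compared.\<close>
  have "1 - zpow 1 dvd qpoch_inf (zpow 1) (fps_X\<^sup>2)"
    using qpoch_inf_Suc[of "fps_X\<^sup>2" "zpow 1"] by (simp add: X_dvd_iff zpow_nth_0_neq_1)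
  then have "1 - zpow 1 dvd ?L - suminf hecke_summand"
    by (intro dvd_diff dvd_suminf_hecke dvd_mult2)
  moreover have "zcoef j (?L - suminf hecke_summand) = 0" if "j \<noteq> 0" for j
    unfolding zcoef_diff zcoef_S2[OF that refl] zcoef_hecke[OF that refl] by simp
  ultimately have "?L - suminf hecke_summand = 0"
    by (rule zcoef_eq_0_if_dvd)
  then show ?thesis
    unfolding f by simp
qed

end
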